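(* For any fixed positive integer $t$ and fixed widths $w_1,\dots,w_t$ (positive integers), the cutting stock problem is solvable in time polynomial in $\sum_{j=1}^t\big\lceil n_j/\lfloor u/w_j\rfloor\big\rceil$ and in the bit size of the numbers $n_1,\dots,n_t$ of orders and the raw roll width $u$.
   Context: The cutting stock problem: a manufacturer supplies rolls of material in one of $t$ different widths $w_1,\dots,w_t$, all cut out of standard rolls of common large integer width $u$, with $u\ge w_j$ for all $j$. Given orders for $n_j$ rolls of width $w_j$ ($n_j$ a nonnegative integer, $j=1,\dots,t$), the problem is to meet the orders using the smallest possible number of standard rolls. That is, find the smallest $m$, together with a corresponding cutting, such that there exist nonnegative integers $x^k_j$ ($1\le k\le m$, $1\le j\le t$), where $x^k_j$ is the number of rolls of width $w_j$ cut out of the $k$th standard roll, with $\sum_{k=1}^m x^k_j=n_j$ for all $j$ and $\sum_{j=1}^t w_jx^k_j\le u$ for all $k$. The numbers $t,w_1,\dots,w_t$ are fixed and not part of the input; the integers $n_j$ and $u$ are encoded in binary. *)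

theory Defs
  imports Complex_Main "HOL-Library.Log_Nat" "HOL-Computational_Algebra.Polynomial"
begin

section \<open>Random access machine with logarithmic cost\<close>

text \<open>
  Running time is measured on a random access machine under the logarithmic cost criterion
  (Aho, Hopcroft, Ullman), which is polynomially equivalent to the Turing machine.
  Programs are structured while programs over an unbounded memory of natural numbers and a
  write-only output tape. Every number that occurs during the evaluation of an expression,
  addresses included, is charged its binary length, so that operations on large numbers are
  not unit-cost.
\<close>

definition bit_size :: "nat \<Rightarrow> nat" where
  "bit_size n = max 1 (floorlog 2 n)"  (* floorlog 2 0 = 0, but writing 0 takes one digit *)

datatype exp =
    Const nat
  | Mem exp
  | Add exp exp
  | Sub exp exp
  | Mul exp exp
  | Div exp exp

type_synonym memory = "nat \<Rightarrow> nat"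

text \<open>Subtraction is truncated, division rounds down, and division by \<open>0\<close> yields \<open>0\<close>.\<close>

fun val :: "exp \<Rightarrow> memory \<Rightarrow> nat" where
  "val (Const c) M = c"
| "val (Mem a) M = M (val a M)"
| "val (Add a b) M = val a M + val b M"
| "val (Sub a b) M = val a M - val b M"
| "val (Mul a b) M = val a M * val b M"
| "val (Div a b) M = val a M div val b M"

fun exp_cost :: "exp \<Rightarrow> memory \<Rightarrow> nat" where
  "exp_cost (Const c) M = bit_size c"
| "exp_cost (Mem a) M = exp_cost a M + bit_size (val (Mem a) M)"
| "exp_cost (Add a b) M = exp_cost a M + exp_cost b M + bit_size (val (Add a b) M)"
| "exp_cost (Sub a b) M = exp_cost a M + exp_cost b M + bit_size (val (Sub a b) M)"
| "exp_cost (Mul a b) M = exp_cost a M + exp_cost b M + bit_size (val (Mul a b) M)"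
| "exp_cost (Div a b) M = exp_cost a M + exp_cost b M + bit_size (val (Div a b) M)"

datatype com =
    Skip
  | Store exp exp  (* address, value *)
  | Write exp
  | Seq com com
  | IfNZ exp com com
  | WhileNZ exp com

type_synonym state = "memory \<times> nat list"

text \<open>
  \<open>exec c s T s'\<close>: started in state \<open>s\<close> (memory and output written so far), \<open>c\<close> terminates
  after time \<open>T\<close> in state \<open>s'\<close>. \<open>IfNZ\<close> and \<open>WhileNZ\<close> test for a nonzero value.
\<close>

inductive exec :: "com \<Rightarrow> state \<Rightarrow> nat \<Rightarrow> state \<Rightarrow> bool" where
  Skip: "exec Skip s 1 s"
| Store: "exec (Store a e) (M, out) (exp_cost a M + exp_cost e M) (M(val a M := val e M), out)"
| Write: "exec (Write e) (M, out) (exp_cost e M) (M, out @ [val e M])"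
| Seq: "exec c s T s' \<Longrightarrow> exec d s' T' s'' \<Longrightarrow> exec (Seq c d) s (T + T') s''"
| IfTrue: "val e (fst s) \<noteq> 0 \<Longrightarrow> exec c s T s' \<Longrightarrow> exec (IfNZ e c d) s (exp_cost e (fst s) + T) s'"
| IfFalse: "val e (fst s) = 0 \<Longrightarrow> exec d s T s' \<Longrightarrow> exec (IfNZ e c d) s (exp_cost e (fst s) + T) s'"
| WhileFalse: "val e (fst s) = 0 \<Longrightarrow> exec (WhileNZ e c) s (exp_cost e (fst s)) s"
| WhileTrue: "val e (fst s) \<noteq> 0 \<Longrightarrow> exec c s T s' \<Longrightarrow> exec (WhileNZ e c) s' T' s''
    \<Longrightarrow> exec (WhileNZ e c) s (exp_cost e (fst s) + T + T') s''"

lemma exec_deterministic: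
  "exec c s T s' \<Longrightarrow> exec c s T2 s2 \<Longrightarrow> T2 = T \<and> s2 = s'"
proof (induction arbitrary: T2 s2 rule: exec.induct)
  case (Skip s)
  then show ?case by (cases rule: exec.cases) simp_all
next
  case (Store a e M out)
  then show ?case by (cases rule: exec.cases) simp_all
next
  case (Write e M out)
  then show ?case by (cases rule: exec.cases) simp_all
next
  case (Seq c s T s' d T' s'')
  from Seq.prems obtain U r U' where
    "exec c s U r" "exec d r U' s2" "T2 = U + U'" by (cases rule: exec.cases) auto
  with Seq.IH show ?case by blast
next
  case (IfTrue e s c T s' d)
  from IfTrue.prems IfTrue.hyps obtain U where
    "exec c s U s2" "T2 = exp_cost e (fst s) + U" by (cases rule: exec.cases) auto
  with IfTrue.IH show ?case by blast
next
  case (IfFalse e s d T s' c)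
  from IfFalse.prems IfFalse.hyps obtain U where
    "exec d s U s2" "T2 = exp_cost e (fst s) + U" by (cases rule: exec.cases) auto
  with IfFalse.IH show ?case by blast
next
  case (WhileFalse e s c)
  from WhileFalse.prems WhileFalse.hyps show ?case by (cases rule: exec.cases) auto
next
  case (WhileTrue e s c T s' T' s'')
  from WhileTrue.prems WhileTrue.hyps obtain U r U' where
    "exec c s U r" "exec (WhileNZ e c) r U' s2" "T2 = exp_cost e (fst s) + U + U'"
    by (cases rule: exec.cases) auto
  with WhileTrue.IH show ?case by blast
qed

definition load :: "nat list \<Rightarrow> memory" where
  "load xs = (\<lambda>i. if i < length xs then xs ! i else 0)"

text \<open>
  A single program has to work for all instances \<open>i \<in> I\<close>. The input \<open>enc i\<close> is placed in the first
  memory cells, and the program has to write some element of \<open>sol i\<close>.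
  The time bound is polynomial in \<open>sz i\<close>; for a bound that is polynomial in several quantities,
  \<open>sz i\<close> is their sum.
\<close>

definition solvable_in_poly_time ::
  "'i set \<Rightarrow> ('i \<Rightarrow> nat list) \<Rightarrow> ('i \<Rightarrow> nat list set) \<Rightarrow> ('i \<Rightarrow> nat) \<Rightarrow> bool" where
  "solvable_in_poly_time I enc sol sz \<longleftrightarrow>
     (\<exists>(c :: com) (p :: nat poly). \<forall>i\<in>I. \<exists>T M out.
        exec c (load (enc i), []) T (M, out) \<and> out \<in> sol i \<and> T \<le> poly p (sz i))"


section \<open>The cutting stock problem\<close>

text \<open>
  The indices \<open>j\<close> of widths and orders range over \<open>{1..t}\<close>, those of standard rolls over \<open>{1..m}\<close>;
  \<open>x k j\<close> is the number of rolls of width \<open>w j\<close> cut out of the \<open>k\<close>-th standard roll.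
\<close>

definition is_cutting ::
  "nat \<Rightarrow> (nat \<Rightarrow> nat) \<Rightarrow> nat \<Rightarrow> (nat \<Rightarrow> nat) \<Rightarrow> nat \<Rightarrow> (nat \<Rightarrow> nat \<Rightarrow> nat) \<Rightarrow> bool" where
  "is_cutting t w u n m x \<longleftrightarrow>
     (\<forall>j\<in>{1..t}. (\<Sum>k=1..m. x k j) = n j) \<and> (\<forall>k\<in>{1..m}. (\<Sum>j=1..t. w j * x k j) \<le> u)"

definition is_optimal_cutting ::
  "nat \<Rightarrow> (nat \<Rightarrow> nat) \<Rightarrow> nat \<Rightarrow> (nat \<Rightarrow> nat) \<Rightarrow> nat \<Rightarrow> (nat \<Rightarrow> nat \<Rightarrow> nat) \<Rightarrow> bool" where
  "is_optimal_cutting t w u n m x \<longleftrightarrow>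
     is_cutting t w u n m x \<and> (\<forall>m' x'. is_cutting t w u n m' x' \<longrightarrow> m \<le> m')"

text \<open>An instance is a pair of the standard width \<open>u\<close> and the orders \<open>n\<close>.\<close>

definition cs_instances :: "nat \<Rightarrow> (nat \<Rightarrow> nat) \<Rightarrow> (nat \<times> (nat \<Rightarrow> nat)) set" where
  "cs_instances t w = {(u, n). \<forall>j\<in>{1..t}. w j \<le> u}"

definition cs_input :: "nat \<Rightarrow> nat \<times> (nat \<Rightarrow> nat) \<Rightarrow> nat list" where
  "cs_input t = (\<lambda>(u, n). u # map n [1..<Suc t])"

definition encode_cutting :: "nat \<Rightarrow> nat \<Rightarrow> (nat \<Rightarrow> nat \<Rightarrow> nat) \<Rightarrow> nat list" where
  "encode_cutting t m x = m # concat (map (\<lambda>k. map (x k) [1..<Suc t]) [1..<Suc m])"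

definition cs_solutions :: "nat \<Rightarrow> (nat \<Rightarrow> nat) \<Rightarrow> nat \<times> (nat \<Rightarrow> nat) \<Rightarrow> nat list set" where
  "cs_solutions t w = (\<lambda>(u, n). {encode_cutting t m x | m x. is_optimal_cutting t w u n m x})"

definition cs_bit_size :: "nat \<Rightarrow> nat \<times> (nat \<Rightarrow> nat) \<Rightarrow> nat" where
  "cs_bit_size t = (\<lambda>(u, n). bit_size u + (\<Sum>j=1..t. bit_size (n j)))"

definition cs_roll_bound :: "nat \<Rightarrow> (nat \<Rightarrow> nat) \<Rightarrow> nat \<times> (nat \<Rightarrow> nat) \<Rightarrow> nat" where
  "cs_roll_bound t w =
     (\<lambda>(u, n). \<Sum>j=1..t. nat \<lceil>real (n j) / real_of_int \<lfloor>real u / real (w j)\<rfloor>\<rceil>)"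

end

theory Submission
  imports Defs
begin

text \<open>
  Among the optimal cuttings take one with least sum of squares. By an exchange argument, any two
  of its standard rolls differ in each entry by at most \<open>D = (w 1 + \<dots> + w t)\<^sup>2\<close>, which does not
  depend on the instance. Hence every entry is within \<open>D\<close> of the average \<open>n j / m\<close>, and only the
  constant number \<open>K = (2 * D + 1) ^ t\<close> of patterns occurs. A cutting is thus described by the
  multiplicities of these patterns. As they are bounded by the number of rolls of a trivial cutting,
  there are polynomially many candidates, which can be searched exhaustively.
\<close>

section \<open>Arithmetic expressions and bounded search on the machine\<close>

text \<open>The number of patterns that fit into a roll of width \<open>u\<close> grows like a power
  of \<open>u\<close>, which is exponential in the bit size, so listing all patterns is too slow.
  Balancing removes this dependence: relative to the average, only a window of constant size remains
  for each width. The constant is the square of \<open>W = w 1 + ... + w t\<close> for this reason.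
  If no swap between two rolls is possible, each other width can favour the lighter roll by at most
  \<open>W\<close> pieces, hence by weight at most \<open>W * W\<close> in total. A surplus of more
  than \<open>W * W\<close> pieces of one width outweighs this. The average depends on the number of
  rolls \<open>m\<close>, which is unknown, and the patterns depend on it too. So a candidate must
  contain \<open>m\<close> besides the multiplicities; this accounts for the exponent
  \<open>K + 1\<close> in the size of the search space. As \<open>t\<close>, \<open>w\<close> and
  \<open>K\<close> are constants, checking one candidate is the evaluation of one fixed expression,
  and only the search and the output need loops.\<close>

lemma bit_size_le_iff: "1 \<le> k \<Longrightarrow> bit_size n \<le> k \<longleftrightarrow> n < 2 ^ k"
  by (simp add: bit_size_def floorlog_le_iff)

lemma less_power_bit_size: "n < 2 ^ bit_size n"
  using bit_size_le_iff[of "bit_size n" n] by (simp add: bit_size_def)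

lemma bit_size_ge_1: "1 \<le> bit_size n"
  by (simp add: bit_size_def)

lemma bit_size_mono: "m \<le> n \<Longrightarrow> bit_size m \<le> bit_size n"
  unfolding bit_size_def using floorlog_mono[of m n 2] by (simp add: max.coboundedI2)

lemma bit_size_le_Suc: "bit_size n \<le> Suc n"
  using bit_size_le_iff[of "Suc n" n] less_exp[of n] by simp

lemma bit_size_mult: "bit_size (m * n) \<le> bit_size m + bit_size n"
proof -
  have "m * n < 2 ^ bit_size m * 2 ^ bit_size n"
    by (intro mult_strict_mono less_power_bit_size) auto
  then show ?thesis
    using bit_size_le_iff[of "bit_size m + bit_size n" "m * n"] bit_size_ge_1[of m]
    by (simp add: power_add)
qed

lemma bit_size_add: "bit_size (m + n) \<le> bit_size m + bit_size n"
proof -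
  \<comment> \<open>Each successor is at most its power of two, and subtracting 1 from the product
    keeps the inequality strict.\<close>
  have "m + n \<le> Suc m * Suc n - 1" by simp
  also have "\<dots> < 2 ^ bit_size m * 2 ^ bit_size n"
    using mult_le_mono[of "Suc m" "2 ^ bit_size m" "Suc n" "2 ^ bit_size n"]
      less_power_bit_size[of m] less_power_bit_size[of n] by simp
  finally show ?thesis
    using bit_size_le_iff[of "bit_size m + bit_size n" "m + n"] bit_size_ge_1[of m]
    by (simp add: power_add)
qed

section \<open>Cost of evaluating a fixed expression\<close>

fun cost_weight :: "exp \<Rightarrow> nat" where
  "cost_weight (Const c) = bit_size c"
| "cost_weight (Mem a) = cost_weight a + 1"
| "cost_weight (Add a b) = 2 * (cost_weight a + cost_weight b)"
| "cost_weight (Sub a b) = 2 * (cost_weight a + cost_weight b)"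
| "cost_weight (Mul a b) = 2 * (cost_weight a + cost_weight b)"
| "cost_weight (Div a b) = 2 * (cost_weight a + cost_weight b)"

lemma bit_size_val_le_cost: "bit_size (val e M) \<le> exp_cost e M"
  by (cases e) auto

text \<open>The result of an operation is no longer than its operands together, and the length of
  each operand is already contained in its cost. So a binary node at most doubles the cost of its
  subtrees. The factor is purely syntactic: a fixed expression costs linear time in the cell size
  \<open>b\<close>.\<close>

lemma exp_cost_le:
  assumes "\<forall>i. bit_size (M i) \<le> b"
  shows "exp_cost e M \<le> cost_weight e * b"
proof -
  have b: "1 \<le> b" using assms bit_size_ge_1 order_trans by blast
  have binary: "exp_cost x M + exp_cost y M + bit_size v \<le> 2 * (cost_weight x + cost_weight y) * b"
    if "exp_cost x M \<le> cost_weight x * b" "exp_cost y M \<le> cost_weight y * b"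
      "bit_size v \<le> bit_size (val x M) + bit_size (val y M)" for x y v
    using that bit_size_val_le_cost[of x M] bit_size_val_le_cost[of y M]
    by (simp add: algebra_simps)
  show ?thesis
  proof (induction e)
    case (Const c)
    then show ?case using b by simp
  next
    case (Mem a)
    then show ?case using assms[rule_format, of "val a M"] by (simp add: algebra_simps)
  next
    case (Add x y)
    then show ?case using binary[OF Add bit_size_add] by simp
  next
    case (Sub x y)
    then show ?case
      using binary[OF Sub, where v = "val x M - val y M"] bit_size_mono[of "val x M - val y M" "val x M"]
      by simp
  next
    case (Mul x y)
    then show ?case using binary[OF Mul bit_size_mult] by simp
  next
    case (Div x y)
    then show ?case
      using binary[OF Div, where v = "val x M div val y M"] bit_size_mono[of "val x M div val y M" "val x M"]
      by simp
  qed
qed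

section \<open>Running time of loops and of the output\<close>

text \<open>\<open>S i\<close> is the predicted state after \<open>i\<close> rounds. The loop makes
  \<open>n\<close> passes through the body and \<open>n + 1\<close> tests, each of cost at most
  \<open>A\<close>. The induction removes the first round, which shifts \<open>S\<close>.\<close>

lemma exec_counted_while:
  assumes "\<And>i. i < n \<Longrightarrow> val e (fst (S i)) \<noteq> 0"
    and "\<And>i. i < n \<Longrightarrow> \<exists>T\<le>A. exec c (S i) T (S (Suc i))"
    and "val e (fst (S n)) = 0"
    and "\<And>i. i \<le> n \<Longrightarrow> exp_cost e (fst (S i)) \<le> A"
  shows "\<exists>T\<le>(2 * n + 1) * A. exec (WhileNZ e c) (S 0) T (S n)"
  using assms
proof (induction n arbitrary: S)
  case 0
  then show ?case using exec.WhileFalse[of e "S 0" c] by auto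
next
  case (Suc n)
  have "\<exists>T\<le>(2 * n + 1) * A. exec (WhileNZ e c) ((\<lambda>i. S (Suc i)) 0) T ((\<lambda>i. S (Suc i)) n)"
    by (rule Suc.IH) (use Suc.prems in auto)
  then obtain T' where T': "T' \<le> (2 * n + 1) * A" "exec (WhileNZ e c) (S (Suc 0)) T' (S (Suc n))"
    by auto
  obtain T where T: "T \<le> A" "exec c (S 0) T (S (Suc 0))" using Suc.prems(2)[of 0] by auto
  have "exec (WhileNZ e c) (S 0) (exp_cost e (fst (S 0)) + T + T') (S (Suc n))"
    using Suc.prems(1)[of 0] T T' by (intro exec.WhileTrue) auto
  moreover have "exp_cost e (fst (S 0)) + T + T' \<le> (2 * Suc n + 1) * A"
    using Suc.prems(4)[of 0] T T' by simp
  ultimately show ?case by blast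
qed

definition write_all :: "exp list \<Rightarrow> com" where
  "write_all es = foldr (\<lambda>e. Seq (Write e)) es Skip"

lemma exec_write_all:
  assumes "\<forall>i. bit_size (M i) \<le> b"
  shows "\<exists>T\<le>(\<Sum>e\<leftarrow>es. cost_weight e) * b + 1.
    exec (write_all es) (M, out) T (M, out @ map (\<lambda>e. val e M) es)"
proof (induction es arbitrary: out)
  case Nil
  then show ?case using exec.Skip by (auto simp: write_all_def)
next
  case (Cons e es)
  obtain T where T: "T \<le> (\<Sum>e\<leftarrow>es. cost_weight e) * b + 1"
    "exec (write_all es) (M, out @ [val e M]) T (M, (out @ [val e M]) @ map (\<lambda>e. val e M) es)"
    using Cons.IH by blast
  have "exec (write_all (e # es)) (M, out) (exp_cost e M + T)
      (M, (out @ [val e M]) @ map (\<lambda>e. val e M) es)"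
    unfolding write_all_def using T(2)
    by (auto intro!: exec.Seq[OF exec.Write] simp: write_all_def)
  moreover have "exp_cost e M + T \<le> (\<Sum>e\<leftarrow>e # es. cost_weight e) * b + 1"
    using T(1) exp_cost_le[OF assms, of e] by (simp add: algebra_simps)
  ultimately show ?case by auto
qed

text \<open>Cell \<open>a\<close> is the countdown. The number of repetitions is evaluated once,
  before the loop, whereas \<open>es\<close> is evaluated anew in each round while \<open>a\<close>
  changes.\<close>

definition write_times :: "nat \<Rightarrow> exp \<Rightarrow> exp list \<Rightarrow> com" where
  "write_times a e es = Seq (Store (Const a) e)
     (WhileNZ (Mem (Const a))
       (Seq (write_all es) (Store (Const a) (Sub (Mem (Const a)) (Const 1)))))"

definition independent :: "nat \<Rightarrow> exp \<Rightarrow> bool" where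
  "independent a e \<longleftrightarrow> (\<forall>M v. val e (M(a := v)) = val e M)"

text \<open>\<open>C\<close> is chosen before the memory and the bounds, so it depends on the
  program alone. \<open>Z\<close> bounds the repetitions, and \<open>bit_size Z \<le> b\<close>
  keeps the countdown within the cell size.\<close>

lemma exec_write_times:
  assumes es: "\<forall>e'\<in>set es. independent a e'"
  shows "\<exists>C. \<forall>M b Z out. (\<forall>i. bit_size (M i) \<le> b) \<and> val e M \<le> Z \<and> bit_size Z \<le> b \<longrightarrow>
    (\<exists>T\<le>C * b * (Z + 1). exec (write_times a e es) (M, out) T
      (M(a := 0), out @ concat (replicate (val e M) (map (\<lambda>e. val e M) es))))"
proof -
  define body where "body = Seq (write_all es) (Store (Const a) (Sub (Mem (Const a)) (Const 1)))"
  define A where "A = (\<Sum>e\<leftarrow>es. cost_weight e) + 1 + cost_weight (Const a)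
    + cost_weight (Sub (Mem (Const a)) (Const 1))"
  define C where "C = cost_weight (Const a) + cost_weight e + 2 * A"
  show ?thesis
  proof (rule exI[of _ C], intro allI impI, elim conjE)
    fix M :: memory and b Z out
    assume b: "\<forall>i. bit_size (M i) \<le> b" and Z: "val e M \<le> Z" "bit_size Z \<le> b"
    have b1: "1 \<le> b" using b bit_size_ge_1 order_trans by blast
    define n where "n = val e M"
    define S where "S i = (M(a := n - i), out @ concat (replicate i (map (\<lambda>e. val e M) es)))" for i
    have n: "n \<le> Z" using Z by (simp add: n_def)
    have bS: "\<forall>j. bit_size (fst (S i) j) \<le> b" for i
      using b order_trans[OF bit_size_mono[of "n - i" Z] Z(2)] n by (auto simp: S_def)
    have "\<exists>T\<le>(2 * n + 1) * (A * b). exec (WhileNZ (Mem (Const a)) body) (S 0) T (S n)"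
    proof (rule exec_counted_while)
      fix i assume i: "i < n"
      then show "val (Mem (Const a)) (fst (S i)) \<noteq> 0" by (simp add: S_def)
      obtain T where T: "T \<le> (\<Sum>e\<leftarrow>es. cost_weight e) * b + 1"
        "exec (write_all es) (S i) T (fst (S i), snd (S i) @ map (\<lambda>e. val e (fst (S i))) es)"
        using exec_write_all[OF bS[of i], of es "snd (S i)"] by auto
      have eq: "(fst (S i))(val (Const a) (fst (S i)) := val (Sub (Mem (Const a)) (Const 1)) (fst (S i)))
          = fst (S (Suc i))"
        using i by (auto simp: S_def)
      have vals: "map (\<lambda>e. val e (fst (S i))) es = map (\<lambda>e. val e M) es"
        using es by (simp add: S_def independent_def)
      have out: "snd (S i) @ map (\<lambda>e. val e M) es = snd (S (Suc i))"
        by (simp add: S_def replicate_append_same[symmetric])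
      have "exec body (S i) (T + (exp_cost (Const a) (fst (S i))
          + exp_cost (Sub (Mem (Const a)) (Const 1)) (fst (S i)))) (S (Suc i))"
        unfolding body_def
        using exec.Seq[OF T(2) exec.Store[of "Const a" "Sub (Mem (Const a)) (Const 1)"]]
        unfolding eq vals out by simp
      moreover have "T + (exp_cost (Const a) (fst (S i))
          + exp_cost (Sub (Mem (Const a)) (Const 1)) (fst (S i))) \<le> A * b"
        using T(1) exp_cost_le[OF bS[of i], of "Const a"] b1
          exp_cost_le[OF bS[of i], of "Sub (Mem (Const a)) (Const 1)"]
        unfolding A_def add_mult_distrib by linarith
      ultimately show "\<exists>T\<le>A * b. exec body (S i) T (S (Suc i))" by blast
    next
      show "val (Mem (Const a)) (fst (S n)) = 0" by (simp add: S_def)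
    next
      fix i assume "i \<le> n"
      have "exp_cost (Mem (Const a)) (fst (S i)) \<le> cost_weight (Mem (Const a)) * b"
        by (rule exp_cost_le[OF bS])
      also have "\<dots> \<le> A * b" by (intro mult_right_mono) (auto simp: A_def)
      finally show "exp_cost (Mem (Const a)) (fst (S i)) \<le> A * b" .
    qed
    then obtain T where T: "T \<le> (2 * n + 1) * (A * b)"
      "exec (WhileNZ (Mem (Const a)) body) (S 0) T (S n)" by blast
    have S0: "S 0 = (M(val (Const a) M := val e M), out)" by (simp add: S_def n_def)
    have "exec (write_times a e es) (M, out) (exp_cost (Const a) M + exp_cost e M + T) (S n)"
      unfolding write_times_def body_def[symmetric]
      by (rule exec.Seq[OF exec.Store]) (use T(2) S0 in simp)
    moreover have "exp_cost (Const a) M + exp_cost e M + T \<le> C * b * (Z + 1)"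
    proof -
      have "exp_cost (Const a) M + exp_cost e M \<le> (cost_weight (Const a) + cost_weight e) * b * (Z + 1)"
        using add_mono[OF exp_cost_le[OF b, of "Const a"] exp_cost_le[OF b, of e]]
        by (simp only: add_mult_distrib[symmetric]) (simp add: trans_le_add1)
      moreover have "T \<le> 2 * A * b * (Z + 1)"
      proof -
        have "(2 * n + 1) * (A * b) \<le> (2 * (Z + 1)) * (A * b)"
          using n by (intro mult_right_mono) auto
        then show ?thesis using T(1) by (simp add: algebra_simps)
      qed
      ultimately show ?thesis by (simp add: C_def algebra_simps)
    qed
    moreover have "S n = (M(a := 0), out @ concat (replicate (val e M) (map (\<lambda>e. val e M) es)))"
      by (simp add: S_def n_def)
    ultimately show "\<exists>T\<le>C * b * (Z + 1). exec (write_times a e es) (M, out) T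
      (M(a := 0), out @ concat (replicate (val e M) (map (\<lambda>e. val e M) es)))"
      by metis
  qed
qed

definition write_blocks :: "nat \<Rightarrow> (exp \<times> exp list) list \<Rightarrow> com" where
  "write_blocks a bs = foldr (\<lambda>(e, es). Seq (write_times a e es)) bs Skip"

definition block_output :: "memory \<Rightarrow> (exp \<times> exp list) list \<Rightarrow> nat list" where
  "block_output M bs = concat (map (\<lambda>(e, es). concat (replicate (val e M) (map (\<lambda>e. val e M) es))) bs)"

lemma exec_write_blocks:
  assumes "\<forall>(e, es)\<in>set bs. independent a e \<and> (\<forall>e'\<in>set es. independent a e')"
  shows "\<exists>C. \<forall>M b Z out. (\<forall>i. bit_size (M i) \<le> b) \<and> (\<forall>(e, es)\<in>set bs. val e M \<le> Z) \<and> bit_size Z \<le> b \<longrightarrow>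
    (\<exists>T\<le>C * b * (Z + 1). \<exists>M'. exec (write_blocks a bs) (M, out) T (M', out @ block_output M bs))"
  using assms
proof (induction bs)
  case Nil
  show ?case
  proof (rule exI[of _ 1], intro allI impI, elim conjE)
    fix M :: memory and b Z out
    assume "\<forall>i. bit_size (M i) \<le> b"
    then have "1 \<le> b" using bit_size_ge_1 order_trans by blast
    moreover have "exec (write_blocks a []) (M, out) 1 (M, out @ block_output M [])"
      using exec.Skip by (simp add: write_blocks_def block_output_def)
    ultimately show "\<exists>T\<le>1 * b * (Z + 1). \<exists>M'. exec (write_blocks a []) (M, out) T (M', out @ block_output M [])"
      by (intro exI[of _ 1]) auto
  qed
next
  case (Cons x bs)
  obtain e es where x: "x = (e, es)" by (cases x)
  have ind: "\<forall>e'\<in>set es. independent a e'" using Cons.prems x by auto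
  obtain C1 where C1: "\<And>M b Z out. (\<forall>i. bit_size (M i) \<le> b) \<and> val e M \<le> Z \<and> bit_size Z \<le> b \<Longrightarrow>
    (\<exists>T\<le>C1 * b * (Z + 1). exec (write_times a e es) (M, out) T
      (M(a := 0), out @ concat (replicate (val e M) (map (\<lambda>e. val e M) es))))"
    using exec_write_times[OF ind, of e] by blast
  have "\<forall>(e, es)\<in>set bs. independent a e \<and> (\<forall>e'\<in>set es. independent a e')"
    using Cons.prems by auto
  from Cons.IH[OF this] obtain C2 where C2: "\<And>M b Z out. (\<forall>i. bit_size (M i) \<le> b) \<and> (\<forall>(e, es)\<in>set bs. val e M \<le> Z) \<and> bit_size Z \<le> b \<Longrightarrow>
    (\<exists>T\<le>C2 * b * (Z + 1). \<exists>M'. exec (write_blocks a bs) (M, out) T (M', out @ block_output M bs))"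
    by blast
  show ?case
  proof (rule exI[of _ "C1 + C2"], intro allI impI, elim conjE)
    fix M :: memory and b Z out
    assume b: "\<forall>i. bit_size (M i) \<le> b" and Z: "\<forall>(e, es)\<in>set (x # bs). val e M \<le> Z" "bit_size Z \<le> b"
    have b1: "1 \<le> b" using b bit_size_ge_1 order_trans by blast
    let ?o = "concat (replicate (val e M) (map (\<lambda>e. val e M) es))"
    obtain T1 where T1: "T1 \<le> C1 * b * (Z + 1)" "exec (write_times a e es) (M, out) T1 (M(a := 0), out @ ?o)"
      using C1[of M b Z out] b Z x by auto
    \<comment> \<open>A finished block has changed only the countdown cell, so the remaining blocks
      still produce their output for the original memory.\<close>
    have same: "val e' (M(a := 0)) = val e' M" if "independent a e'" for e'
      using that by (simp add: independent_def)
    have bits: "\<forall>i. bit_size ((M(a := 0)) i) \<le> b"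
      using b bit_size_mono[of 0 Z] Z(2) by auto
    have vals: "\<forall>(e, es)\<in>set bs. val e (M(a := 0)) \<le> Z"
      using Z(1) Cons.prems same by fastforce
    have outs: "block_output (M(a := 0)) bs = block_output M bs"
      using Cons.prems same unfolding block_output_def
      by (intro arg_cong[where f = concat] map_cong refl) (fastforce cong: map_cong)
    obtain T2 M' where T2: "T2 \<le> C2 * b * (Z + 1)"
      "exec (write_blocks a bs) (M(a := 0), out @ ?o) T2 (M', (out @ ?o) @ block_output M bs)"
      using C2[of "M(a := 0)" b Z "out @ ?o"] bits vals Z(2) unfolding outs by blast
    have "exec (write_blocks a (x # bs)) (M, out) (T1 + T2) (M', out @ block_output M (x # bs))"
      using exec.Seq[OF T1(2) T2(2)] by (simp add: write_blocks_def block_output_def x)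
    moreover have "T1 + T2 \<le> (C1 + C2) * b * (Z + 1)" using T1(1) T2(1) by (simp add: algebra_simps)
    ultimately show "\<exists>T\<le>(C1 + C2) * b * (Z + 1). \<exists>M'.
        exec (write_blocks a (x # bs)) (M, out) T (M', out @ block_output M (x # bs))"
      by blast
  qed
qed

definition search_program :: "nat \<Rightarrow> nat \<Rightarrow> exp \<Rightarrow> exp \<Rightarrow> (exp \<times> exp list) list \<Rightarrow> com" where
  "search_program s a P h bs =
     Seq (WhileNZ P (Store (Const s) (Add (Mem (Const s)) (Const 1))))
       (Seq (Write h) (write_blocks a bs))"

text \<open>The index \<open>i\<^sub>0\<close> is the first zero of \<open>P\<close>. Since
  \<open>i\<^sub>0 \<le> Z\<close>, search index and repetition counts fit into \<open>b\<close>
  bits, so each of the roughly \<open>Z\<close> steps costs a constant times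
  \<open>b\<close>.\<close>

lemma exec_search_program:
  assumes "\<forall>(e, es)\<in>set bs. independent a e \<and> (\<forall>e'\<in>set es. independent a e')"
  shows "\<exists>C. \<forall>M b Z i\<^sub>0. (\<forall>i. bit_size (M i) \<le> b) \<and> M s = 0 \<and> i\<^sub>0 \<le> Z \<and> bit_size Z \<le> b \<and>
      (\<forall>i<i\<^sub>0. val P (M(s := i)) \<noteq> 0) \<and> val P (M(s := i\<^sub>0)) = 0 \<and>
      (\<forall>(e, es)\<in>set bs. val e (M(s := i\<^sub>0)) \<le> Z) \<longrightarrow>
    (\<exists>T\<le>C * b * (Z + 1). \<exists>M'. exec (search_program s a P h bs) (M, []) T
      (M', val h (M(s := i\<^sub>0)) # block_output (M(s := i\<^sub>0)) bs))"
proof -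
  obtain C' where C': "\<And>M b Z out. (\<forall>i. bit_size (M i) \<le> b) \<and> (\<forall>(e, es)\<in>set bs. val e M \<le> Z) \<and> bit_size Z \<le> b \<Longrightarrow>
    (\<exists>T\<le>C' * b * (Z + 1). \<exists>M'. exec (write_blocks a bs) (M, out) T (M', out @ block_output M bs))"
    using exec_write_blocks[OF assms] by blast
  let ?e = "Add (Mem (Const s)) (Const 1)"
  define A where "A = cost_weight P + cost_weight (Const s) + cost_weight ?e"
  define C where "C = 2 * A + cost_weight h + C'"
  show ?thesis
  proof (rule exI[of _ C], intro allI impI, elim conjE)
    fix M :: memory and b Z i\<^sub>0
    assume b: "\<forall>i. bit_size (M i) \<le> b" and Z: "i\<^sub>0 \<le> Z" "bit_size Z \<le> b"
      and s: "M s = 0" and P: "\<forall>i<i\<^sub>0. val P (M(s := i)) \<noteq> 0" "val P (M(s := i\<^sub>0)) = 0"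
      and cnt: "\<forall>(e, es)\<in>set bs. val e (M(s := i\<^sub>0)) \<le> Z"
    define S :: "nat \<Rightarrow> state" where "S i = (M(s := i), [])" for i
    have bS: "\<forall>j. bit_size (fst (S i) j) \<le> b" if "i \<le> i\<^sub>0" for i
      using that b bit_size_mono[of i Z] Z by (auto simp: S_def)
    have "\<exists>T\<le>(2 * i\<^sub>0 + 1) * (A * b). exec (WhileNZ P (Store (Const s) ?e)) (S 0) T (S i\<^sub>0)"
    proof (rule exec_counted_while)
      fix i assume i: "i < i\<^sub>0"
      then show "val P (fst (S i)) \<noteq> 0" using P by (simp add: S_def)
      have "exec (Store (Const s) ?e) (S i) (exp_cost (Const s) (fst (S i)) + exp_cost ?e (fst (S i))) (S (Suc i))"
        using exec.Store[of "Const s" ?e "M(s := i)" "[]"] by (simp add: S_def)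
      moreover have "exp_cost (Const s) (fst (S i)) + exp_cost ?e (fst (S i)) \<le> A * b"
        using exp_cost_le[OF bS[of i], of "Const s"] exp_cost_le[OF bS[of i], of ?e] i
        unfolding A_def add_mult_distrib by linarith
      ultimately show "\<exists>T\<le>A * b. exec (Store (Const s) ?e) (S i) T (S (Suc i))" by blast
    next
      show "val P (fst (S i\<^sub>0)) = 0" using P by (simp add: S_def)
    next
      fix i assume "i \<le> i\<^sub>0"
      then have "exp_cost P (fst (S i)) \<le> cost_weight P * b" by (intro exp_cost_le bS)
      then show "exp_cost P (fst (S i)) \<le> A * b" by (simp add: A_def add_mult_distrib)
    qed
    then obtain T where T: "T \<le> (2 * i\<^sub>0 + 1) * (A * b)"
      "exec (WhileNZ P (Store (Const s) ?e)) (S 0) T (S i\<^sub>0)" by blast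
    have S0: "S 0 = (M, [])" using s by (auto simp: S_def)
    let ?M = "M(s := i\<^sub>0)"
    have bM: "\<forall>i. bit_size (?M i) \<le> b" using bS[of i\<^sub>0] by (simp add: S_def)
    obtain T' M' where T': "T' \<le> C' * b * (Z + 1)"
      "exec (write_blocks a bs) (?M, [val h ?M]) T' (M', [val h ?M] @ block_output ?M bs)"
      using C'[of ?M b Z "[val h ?M]"] bM cnt Z(2) by blast
    have "exec (search_program s a P h bs) (M, []) (T + (exp_cost h ?M + T'))
        (M', val h ?M # block_output ?M bs)"
      unfolding search_program_def
    proof (rule exec.Seq)
      show "exec (WhileNZ P (Store (Const s) ?e)) (M, []) T (?M, [])"
        using T(2) unfolding S0 by (simp add: S_def)
      show "exec (Seq (Write h) (write_blocks a bs)) (?M, []) (exp_cost h ?M + T')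
        (M', val h ?M # block_output ?M bs)"
        by (rule exec.Seq[OF exec.Write]) (use T'(2) in simp)
    qed
    moreover have "T + (exp_cost h ?M + T') \<le> C * b * (Z + 1)"
    proof -
      have "(2 * i\<^sub>0 + 1) * (A * b) \<le> (2 * (Z + 1)) * (A * b)"
        using Z(1) by (intro mult_right_mono) auto
      then have "T \<le> 2 * A * b * (Z + 1)" using T(1) by (simp add: algebra_simps)
      moreover have "exp_cost h ?M \<le> cost_weight h * b * (Z + 1)"
        using exp_cost_le[OF bM, of h] by (simp add: algebra_simps del: fun_upd_apply)
      ultimately show ?thesis using T'(1) by (simp add: C_def algebra_simps)
    qed
    ultimately show "\<exists>T\<le>C * b * (Z + 1). \<exists>M'. exec (search_program s a P h bs) (M, []) T
        (M', val h ?M # block_output ?M bs)"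
      by blast
  qed
qed

section \<open>Balanced cuttings\<close>

text \<open>The replaced term is added on the opposite side, which avoids truncated
  subtraction.\<close>

lemma sum_weighted_upd:
  fixes w f :: "'a \<Rightarrow> nat"
  assumes "finite A" "i \<in> A"
  shows "(\<Sum>p\<in>A. w p * (f(i := v)) p) + w i * f i = (\<Sum>p\<in>A. w p * f p) + w i * v"
proof -
  have "(\<Sum>p\<in>A - {i}. w p * (f(i := v)) p) = (\<Sum>p\<in>A - {i}. w p * f p)"
    by (intro sum.cong) auto
  then show ?thesis
    using sum.remove[OF assms, of "\<lambda>p. w p * (f(i := v)) p"] sum.remove[OF assms, of "\<lambda>p. w p * f p"]
    by simp
qed

lemma sum_squares_transfer_less:
  fixes a b d :: nat
  assumes "b + d < a" "0 < d"
  shows "(a - d)\<^sup>2 + (b + d)\<^sup>2 < a\<^sup>2 + b\<^sup>2"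
proof -
  obtain e where "a = b + d + e" "0 < e" using assms(1) less_imp_add_positive by blast
  \<comment> \<open>With this \<open>e\<close>, the right-hand side exceeds the left-hand side by
    \<open>2 * d * e\<close>.\<close>
  then show ?thesis using assms(2) by (simp add: power2_eq_square algebra_simps)
qed

lemma sum_replace_two:
  fixes g :: "'b \<Rightarrow> nat"
  assumes "finite A" "k \<in> A" "l \<in> A" "k \<noteq> l"
  shows "(\<Sum>i\<in>A. g ((x(k := r, l := s)) i)) + (g (x k) + g (x l)) = (\<Sum>i\<in>A. g (x i)) + (g r + g s)"
proof -
  have split: "(\<Sum>i\<in>A. h i) = h k + h l + (\<Sum>i\<in>A - {k, l}. h i)" for h :: "'a \<Rightarrow> nat"
    using assms by (simp add: sum.remove[of A k h] sum.remove[of "A - {k}" l h] Diff_insert2[symmetric])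
  have "(\<Sum>i\<in>A - {k, l}. g ((x(k := r, l := s)) i)) = (\<Sum>i\<in>A - {k, l}. g (x i))"
    by (intro sum.cong) auto
  then show ?thesis
    using assms(4) split[of "\<lambda>i. g ((x(k := r, l := s)) i)"] split[of "\<lambda>i. g (x i)"] by simp
qed

lemma is_cutting_replace_two:
  assumes cut: "is_cutting t w u n m x" and kl: "k \<in> {1..m}" "l \<in> {1..m}" "k \<noteq> l"
    and rs: "\<And>j. j \<in> {1..t} \<Longrightarrow> r j + s j = x k j + x l j"
    and load: "(\<Sum>j=1..t. w j * r j) \<le> u" "(\<Sum>j=1..t. w j * s j) \<le> u"
  shows "is_cutting t w u n m (x(k := r, l := s))"
  unfolding is_cutting_def
proof (intro conjI ballI)
  fix j assume j: "j \<in> {1..t}"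
  show "(\<Sum>i=1..m. (x(k := r, l := s)) i j) = n j"
    using sum_replace_two[OF _ kl, of "\<lambda>f. f j" x r s] rs[OF j] cut j by (simp add: is_cutting_def)
next
  fix i assume "i \<in> {1..m}"
  then show "(\<Sum>j=1..t. w j * (x(k := r, l := s)) i j) \<le> u"
    using load cut by (simp add: is_cutting_def)
qed

definition square_sum :: "nat \<Rightarrow> nat \<Rightarrow> (nat \<Rightarrow> nat \<Rightarrow> nat) \<Rightarrow> nat" where
  "square_sum t m x = (\<Sum>k=1..m. \<Sum>j=1..t. (x k j)\<^sup>2)"

text \<open>
  In a cutting with least sum of squares no two rolls differ much. If roll \<open>k\<close> contains far more
  pieces \<open>i\<close> than roll \<open>l\<close>, then either \<open>l\<close> contains far more of some other piece \<open>j\<close>, and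
  swapping \<open>w j\<close> pieces \<open>i\<close> against \<open>w i\<close> pieces \<open>j\<close> keeps both loads, or else \<open>k\<close> is heavier than
  \<open>l\<close> by at least \<open>w i\<close>, and one piece \<open>i\<close> can be moved from \<open>k\<close> to \<open>l\<close>.
\<close>

lemma balanced_cutting_exists:
  assumes cut: "is_cutting t w u n m x" and w: "\<And>j. j \<in> {1..t} \<Longrightarrow> 0 < w j"
  shows "\<exists>x. is_cutting t w u n m x \<and>
    (\<forall>k\<in>{1..m}. \<forall>l\<in>{1..m}. \<forall>j\<in>{1..t}. x k j \<le> x l j + (\<Sum>j=1..t. w j)\<^sup>2)"
proof -
  define W where "W = (\<Sum>j=1..t. w j)"
  have wW: "w j \<le> W" if "j \<in> {1..t}" for j
    unfolding W_def using that by (intro member_le_sum) auto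
  obtain x where x: "is_cutting t w u n m x"
    and least: "\<And>y. is_cutting t w u n m y \<Longrightarrow> square_sum t m x \<le> square_sum t m y"
    using ex_has_least_nat[of "is_cutting t w u n m" _ "square_sum t m", OF cut] by blast
  have no_improvement: False
    if kl: "k \<in> {1..m}" "l \<in> {1..m}" "k \<noteq> l"
      and rs: "\<And>j. j \<in> {1..t} \<Longrightarrow> r j + s j = x k j + x l j"
      and load: "(\<Sum>j=1..t. w j * r j) \<le> u" "(\<Sum>j=1..t. w j * s j) \<le> u"
      and le: "\<And>j. j \<in> {1..t} \<Longrightarrow> (r j)\<^sup>2 + (s j)\<^sup>2 \<le> (x k j)\<^sup>2 + (x l j)\<^sup>2"
      and less: "i \<in> {1..t}" "(r i)\<^sup>2 + (s i)\<^sup>2 < (x k i)\<^sup>2 + (x l i)\<^sup>2" for k l i r s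
  proof -
    have "(\<Sum>j=1..t. (r j)\<^sup>2 + (s j)\<^sup>2) < (\<Sum>j=1..t. (x k j)\<^sup>2 + (x l j)\<^sup>2)"
      using le less by (intro sum_strict_mono_ex1) auto
    then have "square_sum t m (x(k := r, l := s)) < square_sum t m x"
      using sum_replace_two[OF _ kl, of "\<lambda>f. \<Sum>j=1..t. (f j)\<^sup>2" x r s]
      by (simp add: square_sum_def sum.distrib)
    then show False
      using least[OF is_cutting_replace_two[OF x kl rs load]] by simp
  qed
  have "x k i \<le> x l i + W\<^sup>2" if k: "k \<in> {1..m}" and l: "l \<in> {1..m}" and i: "i \<in> {1..t}" for k l i
  proof (rule ccontr)
    assume "\<not> ?thesis"
    then have gap: "x l i + W\<^sup>2 < x k i" by simp
    then have kl: "k \<noteq> l" by auto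
    have W1: "0 < W" using wW[OF i] w[OF i] by simp
    then have WW: "W \<le> W\<^sup>2" by (simp add: power2_eq_square)
    have others: "x l j \<le> x k j + W" if j: "j \<in> {1..t}" for j
    proof (rule ccontr)
      assume "\<not> ?thesis"
      then have gap': "x k j + W < x l j" by simp
      have ij: "i \<noteq> j" using gap gap' WW by auto
      define r where "r = (x k)(i := x k i - w j, j := x k j + w i)"
      define s where "s = (x l)(i := x l i + w j, j := x l j - w i)"
      \<comment> \<open>Both gaps exceed the number of pieces moved, since \<open>w i\<close> and
        \<open>w j\<close> are at most \<open>W \<le> W\<^sup>2\<close>. Thus no subtraction is
        truncated and both widths lower the sum of squares.\<close>
      have i_gap: "x l i + w j < x k i" using gap WW wW[OF j] by simp
      have j_gap: "x k j + w i < x l j" using gap' wW[OF i] by simp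
      show False
      proof (rule no_improvement[OF k l kl, of r s])
        show "r p + s p = x k p + x l p" for p using i_gap j_gap ij by (auto simp: r_def s_def)
        have sum_r: "(\<Sum>p=1..t. w p * r p) = (\<Sum>p=1..t. w p * x k p)"
        proof -
          have "w i * (x k i - w j) + w i * w j = w i * x k i"
            using i_gap by (simp add: distrib_left[symmetric])
          then show ?thesis
            using sum_weighted_upd[of "{1..t}" j w "(x k)(i := x k i - w j)" "x k j + w i"]
              sum_weighted_upd[of "{1..t}" i w "x k" "x k i - w j"] i j ij
            by (simp add: r_def algebra_simps)
        qed
        have sum_s: "(\<Sum>p=1..t. w p * s p) = (\<Sum>p=1..t. w p * x l p)"
        proof -
          have "w j * (x l j - w i) + w i * w j = w j * x l j"
            using j_gap by (simp add: distrib_left[symmetric] mult.commute[of "w i"])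
          then show ?thesis
            using sum_weighted_upd[of "{1..t}" j w "(x l)(i := x l i + w j)" "x l j - w i"]
              sum_weighted_upd[of "{1..t}" i w "x l" "x l i + w j"] i j ij
            by (simp add: s_def algebra_simps)
        qed
        show "(\<Sum>p=1..t. w p * r p) \<le> u" "(\<Sum>p=1..t. w p * s p) \<le> u"
          unfolding sum_r sum_s using x k l by (simp_all add: is_cutting_def)
        have i_less: "(x k i - w j)\<^sup>2 + (x l i + w j)\<^sup>2 < (x k i)\<^sup>2 + (x l i)\<^sup>2"
          by (rule sum_squares_transfer_less[OF i_gap w[OF j]])
        have j_less: "(x l j - w i)\<^sup>2 + (x k j + w i)\<^sup>2 < (x l j)\<^sup>2 + (x k j)\<^sup>2"
          by (rule sum_squares_transfer_less[OF j_gap w[OF i]])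
        show "(r p)\<^sup>2 + (s p)\<^sup>2 \<le> (x k p)\<^sup>2 + (x l p)\<^sup>2" for p
          using i_less j_less ij by (auto simp: r_def s_def)
        show "(r i)\<^sup>2 + (s i)\<^sup>2 < (x k i)\<^sup>2 + (x l i)\<^sup>2"
          using i_less ij by (simp add: r_def s_def)
      qed (rule i)
    qed
    define R where "R = {1..t} - {i}"
    have split: "(\<Sum>p=1..t. w p * f p) = w i * f i + (\<Sum>p\<in>R. w p * f p)" for f
      unfolding R_def using i by (simp add: sum.remove)
    \<comment> \<open>The at least \<open>W\<^sup>2 + 1\<close> surplus pieces of width
      \<open>w i\<close> weigh at least \<open>W\<^sup>2 + w i\<close>. The part
      \<open>W\<^sup>2\<close> absorbs whatever the other widths contribute in favour of
      \<open>l\<close>; the part \<open>w i\<close> is the room for the moved piece.\<close>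
    have heavier: "(\<Sum>p=1..t. w p * x l p) + w i \<le> (\<Sum>p=1..t. w p * x k p)"
    proof -
      have "(\<Sum>p\<in>R. w p * x l p) \<le> (\<Sum>p\<in>R. w p * x k p + w p * W)"
        unfolding distrib_left[symmetric] using others
        by (intro sum_mono mult_left_mono) (auto simp: R_def)
      also have "\<dots> = (\<Sum>p\<in>R. w p * x k p) + (\<Sum>p\<in>R. w p) * W"
        by (simp add: sum.distrib sum_distrib_right)
      also have "(\<Sum>p\<in>R. w p) * W \<le> W * W"
        unfolding W_def by (intro mult_right_mono sum_mono2) (auto simp: R_def)
      finally have "(\<Sum>p\<in>R. w p * x l p) \<le> (\<Sum>p\<in>R. w p * x k p) + W\<^sup>2"
        by (simp add: power2_eq_square)
      moreover have "w i * x l i + W\<^sup>2 + w i \<le> w i * x k i"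
      proof -
        have "W\<^sup>2 \<le> w i * W\<^sup>2" using w[OF i] by simp
        then have "w i * x l i + W\<^sup>2 + w i \<le> w i * (x l i + W\<^sup>2 + 1)" by (simp add: algebra_simps)
        also have "\<dots> \<le> w i * x k i" using gap by (intro mult_left_mono) auto
        finally show ?thesis .
      qed
      ultimately show ?thesis unfolding split by linarith
    qed
    define r where "r = (x k)(i := x k i - 1)"
    define s where "s = (x l)(i := x l i + 1)"
    have i_gap: "x l i + 1 < x k i" using gap WW W1 by simp
    have less: "(x k i - 1)\<^sup>2 + (x l i + 1)\<^sup>2 < (x k i)\<^sup>2 + (x l i)\<^sup>2"
      by (rule sum_squares_transfer_less[OF i_gap]) simp
    have load: "(\<Sum>p=1..t. w p * x k p) \<le> u" using x k by (simp add: is_cutting_def)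
    show False
    proof (rule no_improvement[OF k l kl, of r s])
      show "r p + s p = x k p + x l p" for p using i_gap by (auto simp: r_def s_def)
      have "(\<Sum>p=1..t. w p * r p) \<le> (\<Sum>p=1..t. w p * x k p)"
        by (intro sum_mono mult_left_mono) (auto simp: r_def)
      then show "(\<Sum>p=1..t. w p * r p) \<le> u" using load by linarith
      have "(\<Sum>p=1..t. w p * s p) = (\<Sum>p=1..t. w p * x l p) + w i"
        using sum_weighted_upd[of "{1..t}" i w "x l" "x l i + 1"] i by (simp add: s_def)
      then show "(\<Sum>p=1..t. w p * s p) \<le> u" using heavier load by linarith
      show "(r p)\<^sup>2 + (s p)\<^sup>2 \<le> (x k p)\<^sup>2 + (x l p)\<^sup>2" for p
        using less by (auto simp: r_def s_def)
      show "(r i)\<^sup>2 + (s i)\<^sup>2 < (x k i)\<^sup>2 + (x l i)\<^sup>2"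
        using less by (simp add: r_def s_def)
    qed (rule i)
  qed
  then show ?thesis using x unfolding W_def by blast
qed

text \<open>The integers \<open>f k - D\<close> and \<open>f k + D\<close> bound all values of
  \<open>f\<close> from below and above, hence also the average, even after rounding down.\<close>

lemma balanced_near_average:
  fixes f :: "nat \<Rightarrow> nat"
  assumes "\<And>k l. k \<in> {1..m} \<Longrightarrow> l \<in> {1..m} \<Longrightarrow> f k \<le> f l + D" and k: "k \<in> {1..m}"
  shows "f k \<le> (\<Sum>l=1..m. f l) div m + D" "(\<Sum>l=1..m. f l) div m \<le> f k + D"
proof -
  have m: "0 < m" using k by simp
  have "m * (f k - D) \<le> (\<Sum>l=1..m. f l)"
    using sum_bounded_below[of "{1..m}" "f k - D" f] assms(1)[OF k] by (simp add: le_diff_conv)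
  then have "f k - D \<le> (\<Sum>l=1..m. f l) div m"
    using m by (simp add: less_eq_div_iff_mult_less_eq mult.commute)
  then show "f k \<le> (\<Sum>l=1..m. f l) div m + D" by simp
  have "(\<Sum>l=1..m. f l) \<le> m * (f k + D)"
    using sum_bounded_above[of "{1..m}" f "f k + D"] assms(1)[OF _ k] by simp
  then have "(\<Sum>l=1..m. f l) div m \<le> (m * (f k + D)) div m" by (rule div_le_mono)
  then show "(\<Sum>l=1..m. f l) div m \<le> f k + D" using m by simp
qed

section \<open>Cuttings composed of few patterns\<close>

definition digit :: "nat \<Rightarrow> nat \<Rightarrow> nat \<Rightarrow> nat" where
  "digit B s i = s div B ^ i mod B"

lemma digits_exist:
  assumes "\<And>i. i < K \<Longrightarrow> f i < B"
  shows "\<exists>s<B ^ K. \<forall>i<K. digit B s i = f i"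
  using assms
proof (induction K arbitrary: f)
  case 0
  then show ?case by simp
next
  case (Suc K)
  from Suc.IH[of "f \<circ> Suc"] Suc.prems obtain s where
    s: "s < B ^ K" "\<forall>i<K. digit B s i = f (Suc i)" by auto
  have f0: "f 0 < B" using Suc.prems by simp
  have "digit B (f 0 + B * s) i = f i" if "i < Suc K" for i
  proof (cases i)
    case 0
    then show ?thesis using f0 by (simp add: digit_def)
  next
    case (Suc i')
    have "(f 0 + B * s) div (B * B ^ i') = s div B ^ i'"
      using f0 by (simp add: div_mult2_eq)
    then show ?thesis using s(2) that Suc by (simp add: digit_def)
  qed
  moreover have "f 0 + B * s < B ^ Suc K"
  proof -
    have "f 0 + B * s < B * (s + 1)" using f0 by simp
    also have "\<dots> \<le> B * B ^ K" using s(1) by (intro mult_left_mono) auto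
    finally show ?thesis by simp
  qed
  ultimately show ?case by blast
qed

text \<open>
  The \<open>i\<close>-th pattern deviates from the average by the digits of \<open>i\<close>, shifted to the range
  \<open>{- D..D}\<close>. A negative entry is replaced by \<open>0\<close>, which still gives a legitimate pattern.
\<close>

definition pattern :: "nat \<Rightarrow> (nat \<Rightarrow> nat) \<Rightarrow> nat \<Rightarrow> nat \<Rightarrow> nat \<Rightarrow> nat" where
  "pattern D n m i j = n j div m + digit (2 * D + 1) i (j - 1) - D"

text \<open>The patterns are enumerated regardless of their weight, so the width restriction is
  imposed only on those that are used.\<close>

definition valid_counts ::
  "nat \<Rightarrow> (nat \<Rightarrow> nat) \<Rightarrow> nat \<Rightarrow> (nat \<Rightarrow> nat) \<Rightarrow> nat \<Rightarrow> nat \<Rightarrow> (nat \<Rightarrow> nat \<Rightarrow> nat) \<Rightarrow> (nat \<Rightarrow> nat) \<Rightarrow> bool" where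
  "valid_counts t w u n m K a c \<longleftrightarrow>
     (\<Sum>i<K. c i) = m \<and>
     (\<forall>j\<in>{1..t}. (\<Sum>i<K. c i * a i j) = n j) \<and>
     (\<forall>i<K. c i \<noteq> 0 \<longrightarrow> (\<Sum>j=1..t. w j * a i j) \<le> u)"

lemma valid_counts_exist:
  assumes "is_cutting t w u n m x" and "\<And>j. j \<in> {1..t} \<Longrightarrow> 0 < w j"
  defines "D \<equiv> (\<Sum>j=1..t. w j)\<^sup>2"
  shows "\<exists>c. valid_counts t w u n m ((2 * D + 1) ^ t) (pattern D n m) c"
proof -
  obtain x where x: "is_cutting t w u n m x"
    and bal: "\<And>k l j. k \<in> {1..m} \<Longrightarrow> l \<in> {1..m} \<Longrightarrow> j \<in> {1..t} \<Longrightarrow> x k j \<le> x l j + D"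
    using balanced_cutting_exists[OF assms(1,2)] unfolding D_def by blast
  have near: "x k j \<le> n j div m + D \<and> n j div m \<le> x k j + D" if "k \<in> {1..m}" "j \<in> {1..t}" for k j
    using balanced_near_average[of m "\<lambda>k. x k j" D k] bal that x by (simp add: is_cutting_def)
  \<comment> \<open>The deviation from the average, shifted by \<open>D\<close>, lies between 0 and
    \<open>2 * D\<close> and is therefore a digit. Digits are numbered from 0, widths from
    1.\<close>
  have "\<forall>k\<in>{1..m}. \<exists>i<(2 * D + 1) ^ t. \<forall>p<t. digit (2 * D + 1) i p = x k (p + 1) + D - n (p + 1) div m"
  proof
    fix k assume k: "k \<in> {1..m}"
    show "\<exists>i<(2 * D + 1) ^ t. \<forall>p<t. digit (2 * D + 1) i p = x k (p + 1) + D - n (p + 1) div m"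
    proof (rule digits_exist)
      fix p assume "p < t"
      then show "x k (p + 1) + D - n (p + 1) div m < 2 * D + 1"
        using near[OF k, of "p + 1"] by auto
    qed
  qed
  then obtain h where h: "\<And>k. k \<in> {1..m} \<Longrightarrow> h k < (2 * D + 1) ^ t"
    "\<And>k p. k \<in> {1..m} \<Longrightarrow> p < t \<Longrightarrow> digit (2 * D + 1) (h k) p = x k (p + 1) + D - n (p + 1) div m"
    by metis
  have pat: "pattern D n m (h k) j = x k j" if "k \<in> {1..m}" "j \<in> {1..t}" for k j
    using h(2)[of k "j - 1"] near[OF that] that by (auto simp: pattern_def)
  \<comment> \<open>Rolls are grouped by their pattern number, which turns sums over rolls into
    weighted sums over patterns.\<close>
  define c where "c i = card {k \<in> {1..m}. h k = i}" for i
  have count: "(\<Sum>i<(2 * D + 1) ^ t. c i * f i) = (\<Sum>k=1..m. f (h k))" for f :: "nat \<Rightarrow> nat"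
  proof -
    have "(\<Sum>k=1..m. f (h k)) = (\<Sum>i<(2 * D + 1) ^ t. \<Sum>k\<in>{k \<in> {1..m}. h k = i}. f (h k))"
      by (rule sum.group[symmetric]) (use h(1) in auto)
    also have "\<dots> = (\<Sum>i<(2 * D + 1) ^ t. c i * f i)" by (simp add: c_def)
    finally show ?thesis by simp
  qed
  have "valid_counts t w u n m ((2 * D + 1) ^ t) (pattern D n m) c"
    unfolding valid_counts_def
  proof (intro conjI ballI allI impI)
    show "(\<Sum>i<(2 * D + 1) ^ t. c i) = m" using count[of "\<lambda>_. 1"] by simp
  next
    fix j assume j: "j \<in> {1..t}"
    then show "(\<Sum>i<(2 * D + 1) ^ t. c i * pattern D n m i j) = n j"
      unfolding count using pat x by (simp add: is_cutting_def)
  next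
    fix i assume "c i \<noteq> 0"
    then obtain k where k: "k \<in> {1..m}" "h k = i"
      unfolding c_def by (metis (mono_tags, lifting) Collect_empty_eq card.empty)
    have "(\<Sum>j=1..t. w j * pattern D n m i j) = (\<Sum>j=1..t. w j * x k j)"
      using pat[OF k(1)] k(2) by (intro sum.cong) auto
    then show "(\<Sum>j=1..t. w j * pattern D n m i j) \<le> u" using x k(1) by (simp add: is_cutting_def)
  qed
  then show ?thesis by blast
qed

text \<open>The list \<open>L\<close> gives the pattern number of each roll, with equal patterns
  adjacent. In this order the encoding of the cutting is literally the output of the program, block
  by block.\<close>

lemma cutting_of_valid_counts:
  assumes "valid_counts t w u n m K a c"
  shows "\<exists>x. is_cutting t w u n m x \<and>
    encode_cutting t m x = m # concat (map (\<lambda>i. concat (replicate (c i) (map (a i) [1..<Suc t]))) [0..<K])"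
proof -
  define L where "L = concat (map (\<lambda>i. replicate (c i) i) [0..<K])"
  have len: "length L = m"
    using assms by (simp add: L_def length_concat comp_def valid_counts_def interv_sum_list_conv_sum_set_nat
        atLeast0LessThan)
  have nths: "map (\<lambda>k. L ! (k - 1)) [1..<Suc m] = L"
    by (rule nth_equalityI) (auto simp: len simp del: upt_Suc)
  define x where "x k = a (L ! (k - 1))" for k
  have sum_L: "(\<Sum>k=1..m. f (L ! (k - 1))) = (\<Sum>i<K. c i * f i)" for f :: "nat \<Rightarrow> nat"
  proof -
    have "(\<Sum>k=1..m. f (L ! (k - 1))) = sum_list (map f (map (\<lambda>k. L ! (k - 1)) [1..<Suc m]))"
      by (simp add: comp_def interv_sum_list_conv_sum_set_nat atLeastLessThanSuc_atLeastAtMost del: upt_Suc)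
    also have "\<dots> = sum_list (map f L)" unfolding nths ..
    also have "\<dots> = (\<Sum>i\<leftarrow>[0..<K]. c i * f i)"
    proof -
      have "sum_list (map f (concat (map (\<lambda>i. replicate (c i) i) is))) = (\<Sum>i\<leftarrow>is. c i * f i)" for "is"
        by (induction "is") (simp_all add: sum_list_replicate)
      then show ?thesis unfolding L_def .
    qed
    finally show ?thesis by (simp add: interv_sum_list_conv_sum_set_nat atLeast0LessThan)
  qed
  have "is_cutting t w u n m x"
    unfolding is_cutting_def
  proof (intro conjI ballI)
    fix j assume "j \<in> {1..t}"
    then show "(\<Sum>k=1..m. x k j) = n j"
      using assms sum_L[of "\<lambda>i. a i j"] by (simp add: x_def valid_counts_def)
  next
    fix k assume k: "k \<in> {1..m}"
    then have "L ! (k - 1) \<in> set L" using len by (intro nth_mem) auto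
    \<comment> \<open>A number that occurs in \<open>L\<close> has nonzero multiplicity, so the
      width restriction applies to its pattern.\<close>
    then have "L ! (k - 1) < K" "c (L ! (k - 1)) \<noteq> 0" by (auto simp: L_def)
    then show "(\<Sum>j=1..t. w j * x k j) \<le> u" using assms by (simp add: x_def valid_counts_def)
  qed
  moreover have "encode_cutting t m x = m # concat (map (\<lambda>i. map (a i) [1..<Suc t]) L)"
    unfolding encode_cutting_def x_def
    using arg_cong[OF nths, of "\<lambda>L. concat (map (\<lambda>i. map (a i) [1..<Suc t]) L)"]
    by (simp add: comp_def del: upt_Suc)
  moreover have "concat (map (\<lambda>i. map (a i) [1..<Suc t]) L)
      = concat (map (\<lambda>i. concat (replicate (c i) (map (a i) [1..<Suc t]))) [0..<K])"
  proof -
    have "concat (map g (concat (map (\<lambda>i. replicate (c i) i) is))) = concat (map (\<lambda>i. concat (replicate (c i) (g i))) is)"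
      for g :: "nat \<Rightarrow> nat list" and "is"
      by (induction "is") simp_all
    then show ?thesis unfolding L_def .
  qed
  ultimately show ?thesis by auto
qed

text \<open>Every width gets its own rolls: \<open>q\<close> full ones with \<open>d\<close> pieces
  each and one for the remainder, which may be empty. Hence \<open>Suc\<close> instead of rounding
  up.\<close>

lemma trivial_cutting:
  assumes "\<forall>j\<in>{1..t}. 0 < w j \<and> w j \<le> u"
  shows "\<exists>x. is_cutting t w u n (\<Sum>j=1..t. Suc (n j div (u div w j))) x"
  using assms
proof (induction t)
  case 0
  then show ?case by (simp add: is_cutting_def)
next
  case (Suc t)
  define m where "m = (\<Sum>j=1..t. Suc (n j div (u div w j)))"
  from Suc obtain x where x: "is_cutting t w u n m x" unfolding m_def by auto
  define d where "d = u div w (Suc t)"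
  define q where "q = n (Suc t) div d"
  define y where "y k j = (if k \<le> m then (if j \<le> t then x k j else 0)
    else if j = Suc t then (if k - m \<le> q then d else n (Suc t) mod d) else 0)" for k j
  have w: "0 < w (Suc t)" "w (Suc t) \<le> u" using Suc.prems by auto
  have d: "0 < d" "w (Suc t) * d \<le> u" using w by (auto simp: d_def div_greater_zero_iff)
  have "is_cutting (Suc t) w u n (m + Suc q) y"
    unfolding is_cutting_def
  proof (intro conjI ballI)
    fix j assume j: "j \<in> {1..Suc t}"
    have "(\<Sum>k=1..m + Suc q. y k j) = (\<Sum>k=1..m. y k j) + (\<Sum>k=m + 1..m + Suc q. y k j)"
      by (rule sum.ub_add_nat) simp
    also have "(\<Sum>k=m + 1..m + Suc q. y k j) = (\<Sum>k=1..Suc q. y (k + m) j)"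
      using sum.shift_bounds_cl_nat_ivl[of "\<lambda>k. y k j" 1 m "Suc q"] by (simp add: add.commute)
    also have "(\<Sum>k=1..Suc q. y (k + m) j) = (if j = Suc t then n (Suc t) else 0)"
      by (simp add: y_def q_def)
    also have "(\<Sum>k=1..m. y k j) = (if j = Suc t then 0 else n j)"
      using x j by (simp add: y_def is_cutting_def)
    finally show "(\<Sum>k=1..m + Suc q. y k j) = n j" by simp
  next
    fix k assume "k \<in> {1..m + Suc q}"
    show "(\<Sum>j=1..Suc t. w j * y k j) \<le> u"
    proof (cases "k \<le> m")
      case True
      then show ?thesis using x \<open>k \<in> _\<close> by (simp add: y_def is_cutting_def)
    next
      case False
      have "w (Suc t) * (n (Suc t) mod d) \<le> w (Suc t) * d"
        using d(1) by (intro mult_left_mono) (auto simp: less_imp_le)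
      then have "w (Suc t) * (n (Suc t) mod d) \<le> u" using d(2) by linarith
      with False d(2) show ?thesis by (simp add: y_def)
    qed
  qed
  then show ?case by (auto simp: m_def q_def d_def)
qed

section \<open>The search program\<close>

definition sum_exp :: "exp list \<Rightarrow> exp" where
  "sum_exp es = foldr Add es (Const 0)"

definition pow_exp :: "exp \<Rightarrow> nat \<Rightarrow> exp" where
  "pow_exp e k = (Mul e ^^ k) (Const 1)"

text \<open>The machine has no remainder operation, so \<open>d mod B\<close> is computed as
  \<open>d - d div B * B\<close>.\<close>

definition digit_exp :: "exp \<Rightarrow> exp \<Rightarrow> nat \<Rightarrow> exp" where
  "digit_exp B s i = (let d = Div s (pow_exp B i) in Sub d (Mul (Div d B) B))"

definition diff_exp :: "exp \<Rightarrow> exp \<Rightarrow> exp" where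
  "diff_exp a b = Add (Sub a b) (Sub b a)"

lemma val_sum_exp [simp]: "val (sum_exp es) M = (\<Sum>e\<leftarrow>es. val e M)"
  by (induction es) (simp_all add: sum_exp_def)

lemma val_pow_exp [simp]: "val (pow_exp e k) M = val e M ^ k"
  by (induction k) (simp_all add: pow_exp_def)

lemma val_digit_exp [simp]: "val (digit_exp B s i) M = digit (val B M) (val s M) i"
  by (simp add: digit_exp_def digit_def Let_def minus_div_mult_eq_mod)

lemma val_diff_exp_eq_0 [simp]: "val (diff_exp a b) M = 0 \<longleftrightarrow> val a M = val b M"
  by (auto simp: diff_exp_def)

lemma independent_simps [simp]:
  "independent a (Const c)"
  "j \<noteq> a \<Longrightarrow> independent a (Mem (Const j))"
  "independent a x \<Longrightarrow> independent a y \<Longrightarrow> independent a (Add x y)"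
  "independent a x \<Longrightarrow> independent a y \<Longrightarrow> independent a (Sub x y)"
  "independent a x \<Longrightarrow> independent a y \<Longrightarrow> independent a (Mul x y)"
  "independent a x \<Longrightarrow> independent a y \<Longrightarrow> independent a (Div x y)"
  by (simp_all add: independent_def)

lemma independent_sum_exp [simp]: "\<forall>e\<in>set es. independent a e \<Longrightarrow> independent a (sum_exp es)"
  by (induction es) (simp_all add: sum_exp_def)

lemma independent_pow_exp [simp]: "independent a e \<Longrightarrow> independent a (pow_exp e k)"
  by (induction k) (simp_all add: pow_exp_def)

lemma independent_digit_exp [simp]:
  "independent a B \<Longrightarrow> independent a s \<Longrightarrow> independent a (digit_exp B s i)"
  by (simp add: digit_exp_def Let_def)

text \<open>
  Cell \<open>0\<close> holds \<open>u\<close>, the cells \<open>1, \<dots>, t\<close> hold the orders, and cell \<open>t + 1\<close> holds a number \<open>s\<close> that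
  encodes a candidate: in base \<open>B\<close> its digits \<open>0, \<dots>, K - 1\<close> are the multiplicities of the
  patterns, and the number of rolls is stored above them. The rolls occupying the top, searching
  \<open>s\<close> in increasing order finds the least number of rolls first.
\<close>

definition roll_base :: "nat \<Rightarrow> (nat \<Rightarrow> nat) \<Rightarrow> nat \<Rightarrow> (nat \<Rightarrow> nat) \<Rightarrow> nat" where
  "roll_base t w u n = (\<Sum>j=1..t. Suc (n j div (u div w j))) + 1"

definition base_exp :: "nat \<Rightarrow> (nat \<Rightarrow> nat) \<Rightarrow> exp" where
  "base_exp t w = Add (sum_exp (map (\<lambda>j. Add (Div (Mem (Const j)) (Div (Mem (Const 0)) (Const (w j)))) (Const 1))
     [1..<Suc t])) (Const 1)"

definition rolls_exp :: "nat \<Rightarrow> (nat \<Rightarrow> nat) \<Rightarrow> nat \<Rightarrow> exp" where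
  "rolls_exp t w K = Div (Mem (Const (t + 1))) (pow_exp (base_exp t w) K)"

definition count_exp :: "nat \<Rightarrow> (nat \<Rightarrow> nat) \<Rightarrow> nat \<Rightarrow> exp" where
  "count_exp t w i = digit_exp (base_exp t w) (Mem (Const (t + 1))) i"

definition pattern_exp :: "nat \<Rightarrow> (nat \<Rightarrow> nat) \<Rightarrow> nat \<Rightarrow> nat \<Rightarrow> nat \<Rightarrow> nat \<Rightarrow> exp" where
  "pattern_exp t w K D i j =
     Sub (Add (Div (Mem (Const j)) (rolls_exp t w K)) (Const (digit (2 * D + 1) i (j - 1)))) (Const D)"

definition violation_exp :: "nat \<Rightarrow> (nat \<Rightarrow> nat) \<Rightarrow> nat \<Rightarrow> nat \<Rightarrow> exp" where
  "violation_exp t w K D =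
     Add (diff_exp (sum_exp (map (count_exp t w) [0..<K])) (rolls_exp t w K))
    (Add (sum_exp (map (\<lambda>j. diff_exp
            (sum_exp (map (\<lambda>i. Mul (count_exp t w i) (pattern_exp t w K D i j)) [0..<K])) (Mem (Const j)))
          [1..<Suc t]))
         (sum_exp (map (\<lambda>i. Mul (count_exp t w i)
            (Sub (sum_exp (map (\<lambda>j. Mul (Const (w j)) (pattern_exp t w K D i j)) [1..<Suc t])) (Mem (Const 0))))
          [0..<K])))"

definition blocks :: "nat \<Rightarrow> (nat \<Rightarrow> nat) \<Rightarrow> nat \<Rightarrow> nat \<Rightarrow> (exp \<times> exp list) list" where
  "blocks t w K D = map (\<lambda>i. (count_exp t w i, map (pattern_exp t w K D i) [1..<Suc t])) [0..<K]"

text \<open>The expressions read only the cells up to \<open>t + 1\<close>, so cell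
  \<open>t + 2\<close> is free for the countdown.\<close>

lemma independent_blocks:
  "\<forall>(e, es)\<in>set (blocks t w K D). independent (t + 2) e \<and> (\<forall>e'\<in>set es. independent (t + 2) e')"
proof -
  have base: "independent (t + 2) (base_exp t w)"
    by (auto simp: base_exp_def simp del: upt_Suc)
  then show ?thesis
    by (auto simp: blocks_def count_exp_def pattern_exp_def rolls_exp_def simp del: upt_Suc)
qed

context
  fixes t :: nat and w :: "nat \<Rightarrow> nat" and u :: nat and n :: "nat \<Rightarrow> nat" and s :: nat and M :: memory
  assumes M: "M 0 = u" "\<And>j. j \<in> {1..t} \<Longrightarrow> M j = n j" "M (t + 1) = s"
begin

lemma val_base_exp: "val (base_exp t w) M = roll_base t w u n"
  using M by (simp add: base_exp_def roll_base_def comp_def interv_sum_list_conv_sum_set_nat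
      atLeastLessThanSuc_atLeastAtMost del: upt_Suc)

lemma val_rolls_exp: "val (rolls_exp t w K) M = s div roll_base t w u n ^ K"
  using M val_base_exp by (simp add: rolls_exp_def)

lemma val_count_exp: "val (count_exp t w i) M = digit (roll_base t w u n) s i"
  using M val_base_exp by (simp add: count_exp_def)

lemma val_pattern_exp:
  "j \<in> {1..t} \<Longrightarrow> val (pattern_exp t w K D i j) M = pattern D n (s div roll_base t w u n ^ K) i j"
  using M val_rolls_exp by (simp add: pattern_exp_def pattern_def)

lemma val_violation_exp:
  "val (violation_exp t w K D) M = 0 \<longleftrightarrow>
    valid_counts t w u n (s div roll_base t w u n ^ K) K (pattern D n (s div roll_base t w u n ^ K))
      (digit (roll_base t w u n) s)"
proof -
  have upto: "(\<Sum>i\<leftarrow>[0..<K]. f i) = (\<Sum>i<K. f i)" for f :: "nat \<Rightarrow> nat" and K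
    by (simp add: interv_sum_list_conv_sum_set_nat atLeast0LessThan)
  have from1: "(\<Sum>j\<leftarrow>[Suc 0..<Suc t]. f j) = (\<Sum>j=Suc 0..t. f j)" for f :: "nat \<Rightarrow> nat"
    by (simp add: interv_sum_list_conv_sum_set_nat atLeastLessThanSuc_atLeastAtMost del: upt_Suc)
  show ?thesis
    unfolding violation_exp_def valid_counts_def
    by (simp add: comp_def upto from1 val_count_exp val_rolls_exp val_pattern_exp M
        del: upt_Suc cong: sum.cong_simp ball_cong_simp) (auto simp: Ball_def simp del: upt_Suc)
qed

lemma block_output_blocks:
  "block_output M (blocks t w K D) =
    concat (map (\<lambda>i. concat (replicate (digit (roll_base t w u n) s i)
      (map (pattern D n (s div roll_base t w u n ^ K) i) [1..<Suc t]))) [0..<K])"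
proof -
  have "map (\<lambda>j. val (pattern_exp t w K D i j) M) [1..<Suc t]
      = map (pattern D n (s div roll_base t w u n ^ K) i) [1..<Suc t]" for i
    by (simp add: val_pattern_exp del: upt_Suc)
  then show ?thesis
    unfolding block_output_def blocks_def by (simp only: map_map comp_def prod.case val_count_exp)
qed

end

section \<open>Correctness and size of the search\<close>

lemma valid_counts_cong:
  assumes "\<And>i. i < K \<Longrightarrow> c i = c' i"
  shows "valid_counts t w u n m K a c \<longleftrightarrow> valid_counts t w u n m K a c'"
  using assms by (simp add: valid_counts_def)

text \<open>This bounds the search. The program may stop at a smaller valid \<open>s\<close>, but
  then the quotient by \<open>B ^ K\<close>, the number of rolls, is no larger either.\<close>

lemma encoded_optimum_exists:
  fixes t w u n
  defines "D \<equiv> (\<Sum>j=1..t. w j)\<^sup>2"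
  defines "K \<equiv> (2 * D + 1) ^ t" and "B \<equiv> roll_base t w u n"
  assumes w: "\<And>j. j \<in> {1..t} \<Longrightarrow> 0 < w j" "\<And>j. j \<in> {1..t} \<Longrightarrow> w j \<le> u"
  shows "\<exists>s<B ^ (K + 1). valid_counts t w u n (s div B ^ K) K (pattern D n (s div B ^ K)) (digit B s) \<and>
    (\<forall>m x. is_cutting t w u n m x \<longrightarrow> s div B ^ K \<le> m)"
proof -
  define m where "m = (LEAST m. \<exists>x. is_cutting t w u n m x)"
  have ex: "\<exists>x. is_cutting t w u n (B - 1) x"
    using trivial_cutting[of t w u n] w by (auto simp: B_def roll_base_def)
  then have m: "\<exists>x. is_cutting t w u n m x" "m \<le> B - 1"
    unfolding m_def by (rule LeastI, rule Least_le)
  have min: "m \<le> m'" if "is_cutting t w u n m' x'" for m' x'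
    unfolding m_def using that by (intro Least_le) blast
  have mB: "m < B" using m(2) by (simp add: B_def roll_base_def)
  \<comment> \<open>\<open>B\<close> is one more than the number of rolls in the trivial cutting. So
    \<open>m\<close>, and with it every multiplicity, is a digit in base \<open>B\<close>.\<close>
  obtain c where c: "valid_counts t w u n m K (pattern D n m) c"
    using m(1) valid_counts_exist[of t w u n m] w(1) unfolding D_def K_def by blast
  have cm: "c i < B" if "i < K" for i
    using member_le_sum[of i "{..<K}" c] that c mB by (simp add: valid_counts_def)
  obtain s where s: "s < B ^ (K + 1)" "\<And>i. i < K + 1 \<Longrightarrow> digit B s i = (if i < K then c i else m)"
    using digits_exist[of "K + 1" "\<lambda>i. if i < K then c i else m" B] cm mB by metis
  \<comment> \<open>As \<open>s\<close> has only \<open>K + 1\<close> digits, the quotient is the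
    top digit itself.\<close>
  have "s div B ^ K < B" using s(1) by (simp add: less_mult_imp_div_less mult.commute)
  then have "s div B ^ K = m" using s(2)[of K] by (simp add: digit_def)
  moreover have "valid_counts t w u n m K (pattern D n m) (digit B s)"
    using c valid_counts_cong[of K "digit B s" c] s(2) by simp
  ultimately show ?thesis using s(1) min by auto
qed

text \<open>Rounding down is at most rounding up; the excess \<open>t + 1\<close> comes from the
  \<open>Suc\<close> for each width and the final 1.\<close>

lemma roll_base_le: "roll_base t w u n \<le> cs_roll_bound t w (u, n) + (t + 1)"
proof -
  have le: "n j div (u div w j) \<le> nat \<lceil>real (n j) / real_of_int \<lfloor>real u / real (w j)\<rfloor>\<rceil>" for j
  proof -
    have "int (n j div (u div w j)) = \<lfloor>real (n j) / real_of_int \<lfloor>real u / real (w j)\<rfloor>\<rfloor>"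
      by (simp add: floor_divide_of_nat_eq)
    then show ?thesis by linarith
  qed
  have "(\<Sum>j=1..t. Suc (n j div (u div w j))) = (\<Sum>j=1..t. n j div (u div w j)) + t"
    by (simp add: sum_Suc)
  also have "\<dots> \<le> cs_roll_bound t w (u, n) + t"
    unfolding cs_roll_bound_def using le by (simp add: sum_mono)
  finally show ?thesis by (simp add: roll_base_def)
qed

lemma bit_size_load_le: "bit_size (load (cs_input t (u, n)) i) \<le> cs_bit_size t (u, n)"
proof -
  consider "i = 0" | "i \<in> {1..t}" | "t < i" by fastforce
  then show ?thesis
  proof cases
    case 1
    then show ?thesis by (simp add: load_def cs_input_def cs_bit_size_def)
  next
    case 2
    then have "load (cs_input t (u, n)) i = n i"
      by (cases i) (simp_all add: load_def cs_input_def del: upt_Suc)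
    then show ?thesis
      using member_le_sum[of i "{1..t}" "\<lambda>j. bit_size (n j)"] 2 by (simp add: cs_bit_size_def)
  next
    case 3
    then show ?thesis
      using bit_size_mono[of 0 u] by (simp add: load_def cs_input_def cs_bit_size_def trans_le_add1)
  qed
qed

theorem corollary2p6:
  fixes t :: nat and w :: "nat \<Rightarrow> nat"
  assumes "1 \<le> t" and "\<And>j. j \<in> {1..t} \<Longrightarrow> 0 < w j"
  shows "solvable_in_poly_time (cs_instances t w) (cs_input t) (cs_solutions t w)
           (\<lambda>i. cs_roll_bound t w i + cs_bit_size t i)"
proof -
  define D where "D = (\<Sum>j=1..t. w j)\<^sup>2"
  define K where "K = (2 * D + 1) ^ t"
  let ?prog = "search_program (t + 1) (t + 2) (violation_exp t w K D) (rolls_exp t w K) (blocks t w K D)"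
  obtain C where C: "\<And>M b Z i\<^sub>0. (\<forall>i. bit_size (M i) \<le> b) \<and> M (t + 1) = 0 \<and> i\<^sub>0 \<le> Z \<and> bit_size Z \<le> b \<and>
      (\<forall>i<i\<^sub>0. val (violation_exp t w K D) (M(t + 1 := i)) \<noteq> 0) \<and>
      val (violation_exp t w K D) (M(t + 1 := i\<^sub>0)) = 0 \<and>
      (\<forall>(e, es)\<in>set (blocks t w K D). val e (M(t + 1 := i\<^sub>0)) \<le> Z) \<Longrightarrow>
    (\<exists>T\<le>C * b * (Z + 1). \<exists>M'. exec ?prog (M, []) T
      (M', val (rolls_exp t w K) (M(t + 1 := i\<^sub>0)) # block_output (M(t + 1 := i\<^sub>0)) (blocks t w K D)))"
    using exec_search_program[OF independent_blocks, where s = "t + 1" and P = "violation_exp t w K D" and h = "rolls_exp t w K"]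
    by blast
  \<comment> \<open>\<open>q\<close> bounds \<open>B ^ (K + 1)\<close>, via
    \<open>B \<le> t + 1 + sz\<close>. The factors of \<open>p\<close> then bound \<open>b\<close>
    and \<open>B ^ (K + 1) + 1\<close>.\<close>
  define q :: "nat poly" where "q = [:t + 1, 1:] ^ (K + 1)"
  define p where "p = smult C ((q + [:1, 1:]) * (q + 1))"
  show ?thesis
    unfolding solvable_in_poly_time_def
  proof (rule exI[of _ ?prog], rule exI[of _ p], rule ballI)
    fix inst assume "inst \<in> cs_instances t w"
    then obtain u n where inst: "inst = (u, n)" and u: "\<And>j. j \<in> {1..t} \<Longrightarrow> w j \<le> u"
      by (auto simp: cs_instances_def)
    define sz where "sz = cs_roll_bound t w (u, n) + cs_bit_size t (u, n)"
    define B where "B = roll_base t w u n"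
    define M where "M = load (cs_input t (u, n))"
    \<comment> \<open>The crude bound \<open>bit_size k \<le> Suc k\<close> for the search index is
      good enough, as \<open>B ^ (K + 1)\<close> is itself polynomial in the size.\<close>
    define b where "b = B ^ (K + 1) + 1 + cs_bit_size t (u, n)"
    define good where "good s \<longleftrightarrow>
      valid_counts t w u n (s div B ^ K) K (pattern D n (s div B ^ K)) (digit B s)" for s
    have M: "(M(t + 1 := s)) 0 = u" "\<And>j. j \<in> {1..t} \<Longrightarrow> (M(t + 1 := s)) j = n j"
      "(M(t + 1 := s)) (t + 1) = s" for s
      by (auto simp: M_def load_def cs_input_def nth_Cons' simp del: upt_Suc)
    have violation: "val (violation_exp t w K D) (M(t + 1 := s)) = 0 \<longleftrightarrow> good s" for s
      using val_violation_exp[where M = "M(t + 1 := s)", OF M] by (simp add: good_def B_def)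
    obtain s' where s': "s' < B ^ (K + 1)" "good s'"
      "\<And>m x. is_cutting t w u n m x \<Longrightarrow> s' div B ^ K \<le> m"
      using encoded_optimum_exists[of t w u n] assms(2) u unfolding good_def B_def K_def D_def by blast
    define s where "s = (LEAST s. good s)"
    have s: "good s" "\<And>i. i < s \<Longrightarrow> \<not> good i" "s \<le> s'"
      unfolding s_def using LeastI[of good s'] Least_le[of good s'] s'(2) not_less_Least by auto
    have "\<exists>T\<le>C * b * (B ^ (K + 1) + 1). \<exists>M'. exec ?prog (M, []) T
      (M', val (rolls_exp t w K) (M(t + 1 := s)) # block_output (M(t + 1 := s)) (blocks t w K D))"
    proof (rule C, intro conjI allI impI)
      show "bit_size (M i) \<le> b" for i
        using bit_size_load_le[of t u n i] by (simp add: M_def b_def)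
      show "M (t + 1) = 0" by (simp add: M_def load_def cs_input_def)
      show "s \<le> B ^ (K + 1)" using s(3) s'(1) by simp
      show "bit_size (B ^ (K + 1)) \<le> b"
        using bit_size_le_Suc[of "B ^ (K + 1)"] by (simp add: b_def)
      show "val (violation_exp t w K D) (M(t + 1 := i)) \<noteq> 0" if "i < s" for i
        using s(2)[OF that] violation by blast
      show "val (violation_exp t w K D) (M(t + 1 := s)) = 0" using s(1) violation by blast
      have B: "0 < B" by (simp add: B_def roll_base_def)
      have "digit B s i \<le> B ^ (K + 1)" for i
      proof -
        have "digit B s i < B" using B by (simp add: digit_def)
        moreover have "B \<le> B ^ (K + 1)" using B by simp
        ultimately show ?thesis by linarith
      qed
      then show "\<forall>(e, es)\<in>set (blocks t w K D). val e (M(t + 1 := s)) \<le> B ^ (K + 1)"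
        using val_count_exp[where M = "M(t + 1 := s)", OF M] by (auto simp: blocks_def B_def)
    qed
    moreover have "val (rolls_exp t w K) (M(t + 1 := s)) = s div B ^ K"
      using val_rolls_exp[where M = "M(t + 1 := s)", OF M] by (simp add: B_def)
    moreover have "block_output (M(t + 1 := s)) (blocks t w K D) =
        concat (map (\<lambda>i. concat (replicate (digit B s i) (map (pattern D n (s div B ^ K) i) [1..<Suc t]))) [0..<K])"
      using block_output_blocks[where M = "M(t + 1 := s)", OF M] unfolding B_def .
    ultimately obtain T M' where T: "T \<le> C * b * (B ^ (K + 1) + 1)" and
      run: "exec ?prog (M, []) T (M', (s div B ^ K) # concat (map (\<lambda>i. concat (replicate (digit B s i)
        (map (pattern D n (s div B ^ K) i) [1..<Suc t]))) [0..<K]))"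
      by metis
    obtain x where x: "is_cutting t w u n (s div B ^ K) x"
      "encode_cutting t (s div B ^ K) x = (s div B ^ K) # concat (map (\<lambda>i. concat (replicate (digit B s i)
        (map (pattern D n (s div B ^ K) i) [1..<Suc t]))) [0..<K])"
      using cutting_of_valid_counts s(1) unfolding good_def by blast
    \<comment> \<open>The least valid code \<open>s\<close> is at most \<open>s'\<close>, and
      division is monotone, so the minimality of the roll count of \<open>s'\<close> passes to
      \<open>s\<close>.\<close>
    have "s div B ^ K \<le> m" if "is_cutting t w u n m y" for m y
      using div_le_mono[OF s(3), of "B ^ K"] s'(3)[OF that] by simp
    then have "is_optimal_cutting t w u n (s div B ^ K) x"
      using x(1) by (auto simp: is_optimal_cutting_def)
    then have sol: "encode_cutting t (s div B ^ K) x \<in> cs_solutions t w inst"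
      unfolding inst cs_solutions_def by auto
    have "T \<le> poly p sz"
    proof -
      have "B ^ (K + 1) \<le> (t + 1 + sz) ^ (K + 1)"
        using roll_base_le[of t w u n] by (intro power_mono) (auto simp: B_def sz_def)
      also have "\<dots> = poly q sz" by (simp add: q_def algebra_simps)
      finally have Bq: "B ^ (K + 1) \<le> poly q sz" .
      then have "b \<le> poly q sz + (1 + sz)" by (simp add: b_def sz_def)
      then have "C * b * (B ^ (K + 1) + 1) \<le> C * (poly q sz + (1 + sz)) * (poly q sz + 1)"
        using Bq by (intro mult_le_mono) auto
      also have "\<dots> = poly p sz" by (simp add: p_def algebra_simps)
      finally show ?thesis using T by linarith
    qed
    then show "\<exists>T M out. exec ?prog (load (cs_input t inst), []) T (M, out) \<and> out \<in> cs_solutions t w inst \<and>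
        T \<le> poly p (cs_roll_bound t w inst + cs_bit_size t inst)"
      using run sol unfolding x(2) inst M_def sz_def by blast
  qed
qed

end
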